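(* Let $k\in\mathbb N$, $k\ge 1$, let $j=2k-1$, and let $M_0,\dots,M_j$ be real quantities with $M_{j-1}\neq 0$. Let $A=A(M_0,M_1,\dots,M_j)$ be the $(j+1)\times(j+1)$ coefficient matrix, with rows and columns numbered $0,1,\dots,j$, of the closed moment system written in the form $M_t+A(M)M_x=B$, $M=(M_0,\dots,M_j)^T$ (see context). Then $A$ has the following structure. For each $i=0,1,\dots,j-1$, the row number $i$ has a one in the column number $i+1$ (that is, at the $(i+2)$-nd place) and zeros at all remaining places. The last row, number $j$, consists of zeros except for the two elements $$A_{j\,,\,j-1}=-\frac{M_j^2}{M_{j-1}^2},\qquad A_{j\,,\,j}=\frac{2M_j}{M_{j-1}}.$$ The spectrum of $A$ is real and, counted with algebraic multiplicity, consists of the value $\dfrac{M_j}{M_{j-1}}$ of multiplicity $2$ and the value $0$ of multiplicity $j-1$.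
   Context: For a phase space distribution function $F(t,x,v)\ge 0$ ($t\ge 0$, $x,v\in\mathbb R$) satisfying the one-dimensional Vlasov-Poisson equations $F_t+vF_x-E(t,x)F_v=0$, $E_x=1-n$, $n(t,x)=\int_{\mathbb R}F\,dv$, the moments $M_i(t,x)=\int_{\mathbb R}v^iF(t,x,v)\,dv$ (assumed to exist for all $i\ge 0$) satisfy the infinite chain $(M_0)_t+(M_1)_x=0$ and $(M_i)_t+(M_{i+1})_x=-iEM_{i-1}$, $i\ge 1$. The closure at the odd step $j=2k-1$ consists in replacing $M_{j+1}$ by $M_j^2/M_{j-1}$ (equality in the Hölder inequality $M_{2k-1}^2\le M_{2k}M_{2k-2}$). It gives the closed system for $M_0,\dots,M_j$: $$(M_0)_t+(M_1)_x=0,\qquad (M_i)_t+(M_{i+1})_x=-iEM_{i-1}\quad (1\le i\le j-1),\qquad (M_j)_t+\left(\frac{M_j^2}{M_{j-1}}\right)_x=-jEM_{j-1}.$$ (For $j=1$ the middle family is empty.) Carrying out the differentiation in $x$, this system is written as $M_t+A(M)M_x=B$ with $M=(M_0,\dots,M_j)^T$ and $B=(0,-EM_0,-2EM_1,\dots,-jEM_{j-1})^T$; this defines the matrix $A$. Subscripts $t$ and $x$ denote partial derivatives. *)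

theory Defs
  imports "HOL-Analysis.Derivative" "Jordan_Normal_Form.Spectral_Radius"
begin

type_synonym field_tx = "real \<Rightarrow> real \<Rightarrow> real"

definition D_t :: "field_tx \<Rightarrow> field_tx" where
  "D_t u t x = deriv (\<lambda>s. u s x) t"

definition D_x :: "field_tx \<Rightarrow> field_tx" where
  "D_x u t x = deriv (\<lambda>y. u t y) x"

(* deriv is unspecified at points of non-differentiability, so every statement about
   the system below is made under this hypothesis. *)

definition partially_differentiable :: "field_tx \<Rightarrow> real \<Rightarrow> real \<Rightarrow> bool" where
  "partially_differentiable u t x \<longleftrightarrow>
     (\<lambda>s. u s x) differentiable (at t) \<and> (\<lambda>y. u t y) differentiable (at x)"

(* The system for M 0, ..., M j in which M (j+1) is replaced by
   (M j)^2 / M (j - 1), at the point (t, x). It is meant for j >= 1;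
   members M i with i > j are not referred to. *)

definition closed_moment_system ::
    "nat \<Rightarrow> (nat \<Rightarrow> field_tx) \<Rightarrow> field_tx \<Rightarrow> real \<Rightarrow> real \<Rightarrow> bool" where
  "closed_moment_system j M E t x \<longleftrightarrow>
     D_t (M 0) t x + D_x (M 1) t x = 0 \<and>
     (\<forall>i. 1 \<le> i \<and> i \<le> j - 1 \<longrightarrow>
        D_t (M i) t x + D_x (M (i + 1)) t x = - real i * E t x * M (i - 1) t x) \<and>
     D_t (M j) t x + D_x (\<lambda>s y. (M j s y)\<^sup>2 / M (j - 1) s y) t x
       = - real j * E t x * M (j - 1) t x"

definition quasilinear_system ::
    "nat \<Rightarrow> real mat \<Rightarrow> (nat \<Rightarrow> field_tx) \<Rightarrow> field_tx \<Rightarrow> real \<Rightarrow> real \<Rightarrow> bool" where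
  "quasilinear_system j A M E t x \<longleftrightarrow>
     vec (j + 1) (\<lambda>i. D_t (M i) t x) + A *\<^sub>v vec (j + 1) (\<lambda>i. D_x (M i) t x)
       = vec (j + 1) (\<lambda>i. if i = 0 then 0 else - real i * E t x * M (i - 1) t x)"

(* A is the coefficient matrix at the state m if, for all fields passing through
   m at a point, the closed system at this point says the same as
   M_t + A * M_x = B. The derivatives of the fields at the point are unconstrained, and
   A depends on the state only; this pins A down when j >= 1 and
   m (j - 1) ~= 0. *)

definition is_coefficient_matrix :: "nat \<Rightarrow> (nat \<Rightarrow> real) \<Rightarrow> real mat \<Rightarrow> bool" where
  "is_coefficient_matrix j m A \<longleftrightarrow>
     A \<in> carrier_mat (j + 1) (j + 1) \<and>
     (\<forall>M E t x.
        (\<forall>i\<le>j. partially_differentiable (M i) t x \<and> M i t x = m i) \<longrightarrow>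
        (closed_moment_system j M E t x \<longleftrightarrow> quasilinear_system j A M E t x))"

definition moment_matrix :: "nat \<Rightarrow> (nat \<Rightarrow> real) \<Rightarrow> real mat" where
  "moment_matrix j m = (THE A. is_coefficient_matrix j m A)"

end

theory Submission
  imports Defs
begin

text \<open>The matrix is block upper triangular: a nilpotent shift of size \<open>j - 1\<close> and the companion
  block of \<open>(X - r)\<^sup>2\<close>, where \<open>r = M\<^sub>j / M\<^sub>j\<^sub>-\<^sub>1\<close>. The two entries of the last row are the
  partial derivatives of \<open>M\<^sub>j\<^sup>2 / M\<^sub>j\<^sub>-\<^sub>1\<close>.\<close>

unbundle no vec_syntax
unbundle no inner_syntax

text \<open>Here \<open>n\<close> stands for \<open>j - 1\<close>, so the size \<open>n + 2\<close>
  is at least 2 and no subtraction of naturals occurs. The entries \<open>a\<close>,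
  \<open>b\<close> and the ring are left free so that one computation serves the real matrix, its
  complex image and the induction on \<open>n\<close>.\<close>

definition closure_mat :: "nat \<Rightarrow> 'a \<Rightarrow> 'a \<Rightarrow> 'a::comm_ring_1 mat" where
  "closure_mat n a b = mat (n + 2) (n + 2) (\<lambda>(i, l).
     if i < n + 1 then (if l = i + 1 then 1 else 0)
     else if l = n then a else if l = n + 1 then b else 0)"

lemma closure_mat_carrier [simp]: "closure_mat n a b \<in> carrier_mat (Suc (Suc n)) (Suc (Suc n))"
  by (simp add: closure_mat_def)

lemma dim_closure_mat [simp]:
  "dim_row (closure_mat n a b) = Suc (Suc n)" "dim_col (closure_mat n a b) = Suc (Suc n)"
  by (simp_all add: closure_mat_def)

text \<open>The ones start in column 1, and \<open>a\<close>, \<open>b\<close> sit in the last two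
  of at least three columns, so column 0 vanishes. Deleting the first row and column leaves the same
  shape, one size smaller.\<close>

lemma closure_mat_Suc:
  "closure_mat (Suc n) a b =
     four_block_mat (0\<^sub>m 1 1) (mat 1 (n + 2) (\<lambda>(i, l). if l = 0 then 1 else 0))
       (0\<^sub>m (n + 2) 1) (closure_mat n a b)"
  (is "_ = ?R")
proof (rule eq_matI)
  fix i l
  assume "i < dim_row ?R" "l < dim_col ?R"
  then show "closure_mat (Suc n) a b $$ (i, l) = ?R $$ (i, l)"
    by (cases i; cases l) (simp_all add: closure_mat_def)
qed (simp_all add: closure_mat_def)

lemma char_poly_zero_1: "char_poly (0\<^sub>m 1 1 :: 'a::comm_ring_1 mat) = [:0, 1:]"
  by (simp add: char_poly_defs det_single)

text \<open>Each zero block of size 1 split off by \<open>closure_mat_Suc\<close> contributes a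
  factor X. What remains at the end is the companion block, with polynomial X^2 - b X - a.\<close>

lemma char_poly_closure_mat:
  fixes a b :: "'a::idom"
  shows "char_poly (closure_mat n a b) = [:0, 1:] ^ n * [:- a, - b, 1:]"
proof (induction n)
  case 0
  have "char_poly_matrix (closure_mat 0 a b) \<in> carrier_mat (Suc (Suc 0)) (Suc (Suc 0))"
    by (simp add: char_poly_matrix_def closure_mat_def)
  then show ?case
    by (subst char_poly_def, subst laplace_expansion_row[where i = 0])
      (auto simp: char_poly_matrix_def cofactor_def mat_delete_def det_single
        closure_mat_def numeral_2_eq_2)
next
  case (Suc n)
  have "char_poly (closure_mat (Suc n) a b)
      = char_poly (0\<^sub>m 1 1 :: 'a mat) * char_poly (closure_mat n a b)"
    unfolding closure_mat_Suc
    by (rule char_poly_four_block_zeros_col) (simp_all del: One_nat_def)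
  then show ?case
    by (simp only: char_poly_zero_1 Suc power_Suc mult.assoc)
qed

lemma map_closure_mat:
  "map_mat complex_of_real (closure_mat n a b) = closure_mat n (of_real a) (of_real b)"
  by (rule eq_matI) (auto simp: closure_mat_def)

text \<open>The quotient rule makes the only nonlinear flux linear in the \<open>D_x\<close> terms;
  its two coefficients become \<open>a\<close> and \<open>b\<close> of
  \<open>closure_mat\<close>.\<close>

lemma D_x_square_divide:
  assumes "partially_differentiable u t x" "partially_differentiable w t x" "w t x \<noteq> 0"
  shows "D_x (\<lambda>s y. (u s y)\<^sup>2 / w s y) t x
    = - ((u t x)\<^sup>2 / (w t x)\<^sup>2) * D_x w t x + 2 * u t x / w t x * D_x u t x"
proof -
  have "((\<lambda>y. u t y) has_real_derivative D_x u t x) (at x)"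
    "((\<lambda>y. w t y) has_real_derivative D_x w t x) (at x)"
    using assms(1,2)
    by (auto simp: partially_differentiable_def D_x_def real_differentiable_def
        DERIV_imp_deriv)
  then have "((\<lambda>y. (u t y)\<^sup>2 / w t y) has_real_derivative
     - ((u t x)\<^sup>2 / (w t x)\<^sup>2) * D_x w t x + 2 * u t x / w t x * D_x u t x) (at x)"
    using assms(3)
    by (auto intro!: derivative_eq_intros simp: field_simps power2_eq_square)
  then show ?thesis
    unfolding D_x_def by (rule DERIV_imp_deriv)
qed

lemma row_closure_mat:
  assumes "i < n + 1"
  shows "row (closure_mat n a b) i = unit_vec (n + 2) (i + 1)"
  using assms by (intro eq_vecI) (auto simp: closure_mat_def)

lemma row_last_closure_mat:
  "row (closure_mat n a b) (n + 1)
    = a \<cdot>\<^sub>v unit_vec (n + 2) n + b \<cdot>\<^sub>v unit_vec (n + 2) (n + 1)"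
  by (rule eq_vecI) (auto simp: closure_mat_def)

lemma closure_mat_mult_vec:
  assumes i: "i < n + 2" and q: "q \<in> carrier_vec (n + 2)"
  shows "(closure_mat n a b *\<^sub>v q) $ i
    = (if i < n + 1 then q $ (i + 1) else a * q $ n + b * q $ (n + 1))"
proof -
  have *: "(closure_mat n a b *\<^sub>v q) $ i = row (closure_mat n a b) i \<bullet> q"
    using i by (subst index_mult_mat_vec) (simp_all add: closure_mat_def)
  show ?thesis
  proof (cases "i < n + 1")
    case True
    then show ?thesis
      using q unfolding * row_closure_mat[OF True] by simp
  next
    case False
    then have "i = n + 1" using i by simp
    then show ?thesis
      using q unfolding * by (simp add: row_last_closure_mat[simplified]
          add_scalar_prod_distrib[where n = "n + 2"])
  qed
qed

text \<open>Written row by row, the system takes the three-clause form of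
  \<open>closed_moment_system\<close>, so comparing the two reduces to the last clause.\<close>

lemma quasilinear_system_closure_mat:
  fixes M E t x
  defines "P \<equiv> \<lambda>i. D_t (M i) t x" and "Q \<equiv> \<lambda>i. D_x (M i) t x"
    and "F \<equiv> \<lambda>i. - real i * E t x * M (i - 1) t x"
  shows "quasilinear_system (n + 1) (closure_mat n a b) M E t x \<longleftrightarrow>
    P 0 + Q 1 = 0 \<and> (\<forall>i. 1 \<le> i \<and> i \<le> n \<longrightarrow> P i + Q (i + 1) = F i) \<and>
    P (n + 1) + (a * Q n + b * Q (n + 1)) = F (n + 1)"
proof -
  have "quasilinear_system (n + 1) (closure_mat n a b) M E t x \<longleftrightarrow>
    (\<forall>i<n + 2. P i + (closure_mat n a b *\<^sub>v vec (n + 2) Q) $ i = (if i = 0 then 0 else F i))"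
    unfolding quasilinear_system_def P_def Q_def F_def Matrix.vec_eq_iff
    by (simp del: index_mult_mat_vec)
  also have "\<dots> \<longleftrightarrow> (\<forall>i<n + 2. P i + (if i < n + 1 then Q (i + 1) else a * Q n + b * Q (n + 1))
      = (if i = 0 then 0 else F i))"
    by (intro all_cong) (subst closure_mat_mult_vec, auto)
  \<comment> \<open>The index range is split into the first row, the rows of the middle family (none
    if \<open>n = 0\<close>) and the last row.\<close>
  also have "\<dots> \<longleftrightarrow> (\<forall>i\<in>insert 0 (insert (n + 1) {1..n}).
      P i + (if i < n + 1 then Q (i + 1) else a * Q n + b * Q (n + 1))
      = (if i = 0 then 0 else F i))"
  proof -
    have "i < n + 2 \<longleftrightarrow> i \<in> insert 0 (insert (n + 1) {1..n})" for i
      by auto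
    then show ?thesis by (simp only: Ball_def)
  qed
  also have "\<dots> \<longleftrightarrow> P 0 + Q 1 = 0 \<and> (\<forall>i. 1 \<le> i \<and> i \<le> n \<longrightarrow> P i + Q (i + 1) = F i) \<and>
    P (n + 1) + (a * Q n + b * Q (n + 1)) = F (n + 1)"
    by auto
  finally show ?thesis .
qed

text \<open>The first clauses agree literally, and \<open>D_x_square_divide\<close> identifies the
  last one.\<close>

lemma is_coefficient_matrix_closure_mat:
  assumes "m n \<noteq> 0"
  shows "is_coefficient_matrix (n + 1) m
    (closure_mat n (- ((m (n + 1))\<^sup>2 / (m n)\<^sup>2)) (2 * m (n + 1) / m n))"
  unfolding is_coefficient_matrix_def
proof (intro conjI allI impI)
  fix M E t x
  assume "\<forall>i\<le>n + 1. partially_differentiable (M i) t x \<and> M i t x = m i"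
  then have "partially_differentiable (M (n + 1)) t x" "partially_differentiable (M n) t x"
    "M (n + 1) t x = m (n + 1)" "M n t x = m n"
    by auto
  then show "closed_moment_system (n + 1) M E t x \<longleftrightarrow> quasilinear_system (n + 1)
      (closure_mat n (- ((m (n + 1))\<^sup>2 / (m n)\<^sup>2)) (2 * m (n + 1) / m n)) M E t x"
    using assms D_x_square_divide[of "M (n + 1)" t x "M n"]
    unfolding closed_moment_system_def quasilinear_system_closure_mat by simp
qed (use closure_mat_carrier in simp)

text \<open>Affine fields through the state realise arbitrary derivatives at a point, so with
  \<open>E = 0\<close> the system fixes the product of the matrix with every vector.\<close>

lemma is_coefficient_matrix_unique:
  assumes A: "is_coefficient_matrix j m A" and B: "is_coefficient_matrix j m B"
  shows "A = B"
proof -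
  have dim: "A \<in> carrier_mat (j + 1) (j + 1)" "B \<in> carrier_mat (j + 1) (j + 1)"
    using A B by (auto simp: is_coefficient_matrix_def)
  have "A *\<^sub>v q = B *\<^sub>v q" if q: "q \<in> carrier_vec (j + 1)" for q
  proof -
    \<comment> \<open>The time slopes \<open>p\<close> are chosen so that fields with space slopes
      \<open>q\<close> satisfy the system of \<open>A\<close> at the origin.\<close>
    define p where "p = - (A *\<^sub>v q)"
    define M :: "nat \<Rightarrow> field_tx" where "M = (\<lambda>i s y. m i + p $ i * s + q $ i * y)"
    have p: "p \<in> carrier_vec (j + 1)" using dim q by (simp add: p_def)
    have M: "\<forall>i\<le>j. partially_differentiable (M i) 0 0 \<and> M i 0 0 = m i"
      by (auto simp: partially_differentiable_def M_def)
    have D: "D_t (M i) 0 0 = p $ i" "D_x (M i) 0 0 = q $ i" for i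
      unfolding D_t_def D_x_def M_def
      by (auto intro!: DERIV_imp_deriv derivative_eq_intros)
    have *: "quasilinear_system j C M (\<lambda>_ _. 0) 0 0 \<longleftrightarrow> p + C *\<^sub>v q = 0\<^sub>v (j + 1)" for C
    proof -
      have "vec (j + 1) (\<lambda>i. p $ i) = p" "vec (j + 1) (\<lambda>i. q $ i) = q"
        using p q by auto
      moreover have "vec (j + 1) (\<lambda>i. if i = 0 then 0 else - real i * 0 * M (i - 1) 0 0)
          = 0\<^sub>v (j + 1)"
        by auto
      ultimately show ?thesis
        unfolding quasilinear_system_def D by simp
    qed
    have "p + A *\<^sub>v q = 0\<^sub>v (j + 1)"
      using dim q by (auto simp: p_def)
    \<comment> \<open>The closed system is the link: at this state it is equivalent to the
      quasilinear system of \<open>A\<close> and to that of \<open>B\<close>.\<close>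
    then have "p + B *\<^sub>v q = 0\<^sub>v (j + 1)"
      using A B M * unfolding is_coefficient_matrix_def by metis
    moreover have "A *\<^sub>v q \<in> carrier_vec (j + 1)" "B *\<^sub>v q \<in> carrier_vec (j + 1)"
      using dim q by auto
    moreover have "u = w"
      if "u \<in> carrier_vec (j + 1)" "w \<in> carrier_vec (j + 1)" "- u + w = 0\<^sub>v (j + 1)"
      for u w :: "real vec"
      using that by (auto simp: Matrix.vec_eq_iff)
    ultimately show ?thesis
      unfolding p_def by blast
  qed
  then have "A *\<^sub>v unit_vec (j + 1) l = B *\<^sub>v unit_vec (j + 1) l" for l
    by simp
  moreover have "C $$ (i, l) = (C *\<^sub>v unit_vec (j + 1) l) $ i"
    if "C \<in> carrier_mat (j + 1) (j + 1)" "i < j + 1" "l < j + 1" for C :: "real mat" and i l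
    using that by simp
  ultimately have "A $$ (i, l) = B $$ (i, l)" if "i < j + 1" "l < j + 1" for i l
    using dim that by metis
  then show ?thesis
    using dim by (intro eq_matI) auto
qed

theorem lemma2p1:
  fixes k j :: nat and m :: "nat \<Rightarrow> real" and A :: "real mat"
  assumes "k \<ge> 1" and "j = 2 * k - 1" and "m (j - 1) \<noteq> 0"
    and "A = moment_matrix j m"
  shows "is_coefficient_matrix j m A
    \<and> A \<in> carrier_mat (j + 1) (j + 1)
    \<and> (\<forall>i<j. \<forall>l\<le>j. A $$ (i, l) = (if l = i + 1 then 1 else 0))
    \<and> A $$ (j, j - 1) = - ((m j)\<^sup>2 / (m (j - 1))\<^sup>2)
    \<and> A $$ (j, j) = 2 * m j / m (j - 1)
    \<and> (\<forall>l\<le>j. l \<noteq> j - 1 \<and> l \<noteq> j \<longrightarrow> A $$ (j, l) = 0)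
    \<and> spectrum (map_mat complex_of_real A) \<subseteq> \<real>
    \<and> proots (char_poly (map_mat complex_of_real A))
        = replicate_mset 2 (complex_of_real (m j / m (j - 1))) + replicate_mset (j - 1) 0"
proof -
  define n where "n = j - 1"
  have j: "j = n + 1" using assms(1,2) by (simp add: n_def)
  define r where "r = m j / m n"
  \<comment> \<open>Existence and uniqueness together make the \<open>THE\<close> in
    \<open>moment_matrix\<close> denote this matrix.\<close>
  have A: "A = closure_mat n (- r\<^sup>2) (2 * r)" and coeff: "is_coefficient_matrix j m A"
    using is_coefficient_matrix_closure_mat[of m n] is_coefficient_matrix_unique assms(3)
    unfolding assms(4) moment_matrix_def j r_def
    by (auto simp: power_divide intro: theI the_equality)
  \<comment> \<open>For \<open>a = - r\<^sup>2\<close> and \<open>b = 2 * r\<close> the quadratic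
    factor is the square of X - r.\<close>
  have cp: "char_poly (map_mat complex_of_real A)
      = [:0, 1:] ^ n * [:- complex_of_real r, 1:] ^ 2"
    unfolding A map_closure_mat char_poly_closure_mat
    by (simp add: power2_eq_square)
  have "proots (char_poly (map_mat complex_of_real A))
      = replicate_mset 2 (complex_of_real r) + replicate_mset n 0"
    unfolding cp by (subst proots_mult) (auto simp: proots_power)
  moreover have "spectrum (map_mat complex_of_real A) \<subseteq> \<real>"
  proof -
    have "map_mat complex_of_real A \<in> carrier_mat (n + 2) (n + 2)"
      unfolding A map_closure_mat by simp
    then show ?thesis
      \<comment> \<open>The eigenvalues are the roots of this product, hence 0 or the real number
        \<open>r\<close>.\<close>
      by (subst spectrum_root_char_poly) (auto simp: cp)
  qed
  ultimately show ?thesis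
    using coeff unfolding j r_def A by (auto simp: closure_mat_def r_def j power_divide)
qed

end
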